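(* For all natural numbers $n,m\in\mathbb{N}$ there exist natural numbers $l_0,l_1\in\mathbb{N}$ such that $$\gcd(n,m)+l_0\cdot n=l_1\cdot m\quad\text{or}\quad \gcd(n,m)+l_0\cdot m=l_1\cdot n .$$
   Context: $\mathbb{N}=\{0,1,2,\dots\}$. The greatest common divisor on $\mathbb{N}$ is the function defined recursively by $\gcd(0,n)=n$, $\gcd(m,0)=m$, and $\gcd(m+1,n+1)=\gcd(m+1,n-m)$ if $m<n$, $\gcd(m+1,n+1)=\gcd(m-n,n+1)$ otherwise. The existential quantifiers and the disjunction are understood constructively. *)

theory Defs
  imports Main
begin

fun sub_gcd :: "nat \<Rightarrow> nat \<Rightarrow> nat" where
  "sub_gcd 0 n = n"
| "sub_gcd m 0 = m"
| "sub_gcd (Suc m) (Suc n) =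
     (if m < n then sub_gcd (Suc m) (n - m) else sub_gcd (m - n) (Suc n))"

lemma sub_gcd_eq_gcd: "sub_gcd m n = gcd m n"
proof (induction m n rule: sub_gcd.induct)
  case (3 m n)
  show ?case
  proof (cases "m < n")
    case True
    have "gcd (Suc m) (n - m) = gcd (Suc m) (Suc n)"
      using gcd_diff1_nat[of "Suc m" "Suc n"] True by (simp add: gcd.commute)
    with 3 True show ?thesis by simp
  next
    case False
    have "gcd (m - n) (Suc n) = gcd (Suc m) (Suc n)"
      using gcd_diff1_nat[of "Suc n" "Suc m"] False by simp
    with 3 False show ?thesis by simp
  qed
qed simp_all

text \<open>
  Total recursive functions of a given arity \<open>k\<close>, as functions on argument lists. Only the values on
  lists of length \<open>k\<close> are meaningful. Unbounded minimisation is restricted to regular functions,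
  those for which the search always succeeds, so that exactly the total computable functions arise.
\<close>

inductive recursive_fn :: "nat \<Rightarrow> (nat list \<Rightarrow> nat) \<Rightarrow> bool" where
  zero: "recursive_fn k (\<lambda>xs. 0)"
| succ: "recursive_fn 1 (\<lambda>xs. Suc (xs ! 0))"
| proj: "i < k \<Longrightarrow> recursive_fn k (\<lambda>xs. xs ! i)"
| comp: "recursive_fn (length gs) f \<Longrightarrow> (\<And>g. g \<in> set gs \<Longrightarrow> recursive_fn k g) \<Longrightarrow>
    recursive_fn k (\<lambda>xs. f (map (\<lambda>g. g xs) gs))"
| prec: "recursive_fn k f \<Longrightarrow> recursive_fn (Suc (Suc k)) g \<Longrightarrow>
    recursive_fn (Suc k)
      (\<lambda>xs. rec_nat (f (tl xs)) (\<lambda>y r. g (y # r # tl xs)) (hd xs))"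
| mini: "recursive_fn (Suc k) f \<Longrightarrow> (\<And>xs. length xs = k \<Longrightarrow> \<exists>y. f (y # xs) = 0) \<Longrightarrow>
    recursive_fn k (\<lambda>xs. LEAST y. f (y # xs) = 0)"

text \<open>
  HOL is classical, and choice turns any \<open>\<forall>\<exists>\<close> statement into the existence of functions. The constructive
  reading of \<open>\<exists>\<close> and \<open>\<or>\<close> is therefore expressed as in Kleene's number realizability: the witnesses,
  and the choice of a disjunct (coded as \<open>0\<close> for the left one and any other number for the right
  one), have to be computable from the universally quantified variables.
\<close>

definition computable2 :: "(nat \<Rightarrow> nat \<Rightarrow> nat) \<Rightarrow> bool" where
  "computable2 h \<longleftrightarrow> (\<exists>f. recursive_fn 2 f \<and> (\<forall>n m. f [n, m] = h n m))"

end

theory Submission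
  imports Defs
begin

text \<open>
  If \<open>m > 0\<close>, Bezout's identity over \<open>\<nat>\<close> can always be solved with the first disjunct:
  the coefficient of \<open>n\<close> in an integer solution can be made as negative as desired by adding
  multiples of \<open>m / gcd n m\<close>. If \<open>m = 0\<close>, the gcd is \<open>n\<close> and the second disjunct holds with
  \<open>l1 = 1\<close>. Hence the disjunct can be decided by testing \<open>m = 0\<close>, and what remains is to compute
  the coefficients for \<open>m > 0\<close>.

  Since solutions are known to exist, they can be found by unbounded search instead of running
  Euclid's algorithm, whose simultaneous recursion on two arguments would have to be encoded:
  \<^item> \<open>q = m / gcd n m\<close> is the least positive number such that \<open>m\<close> divides \<open>q * n\<close>;
  \<^item> \<open>g = gcd n m\<close> is the least number with \<open>m \<le> g * q\<close>;
  \<^item> \<open>l0\<close> is the least number such that \<open>m\<close> divides \<open>g + l0 * n\<close>;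
  \<^item> \<open>l1\<close> is the least number with \<open>g + l0 * n \<le> l1 * m\<close>, and equality holds by divisibility.

  Minimisation is admitted only if the search succeeds on all arguments, including \<open>m = 0\<close>. A factor
  \<open>m\<close> in the tested quantity makes it succeed at once there, wherever it does not do so anyway. The tests themselves involve only
  sums, products, truncated differences and remainders, which are primitive recursive.
\<close>

section \<open>Closure properties of the recursive functions\<close>

text \<open>
  A \<^const>\<open>recursive_fn\<close> of arity \<open>k\<close> has particular, meaningless values on lists of other lengths.
  Abstracting from these makes the class closed under pointwise equality on the lists that matter.
\<close>

definition recursive_on :: "nat \<Rightarrow> (nat list \<Rightarrow> nat) \<Rightarrow> bool" where
  "recursive_on k h \<longleftrightarrow> (\<exists>f. recursive_fn k f \<and> (\<forall>xs. length xs = k \<longrightarrow> f xs = h xs))"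

lemma recursive_onI: "recursive_fn k f \<Longrightarrow> (\<And>xs. length xs = k \<Longrightarrow> f xs = h xs) \<Longrightarrow> recursive_on k h"
  unfolding recursive_on_def by blast

lemma recursive_onE:
  assumes "recursive_on k h"
  obtains f where "recursive_fn k f" "\<And>xs. length xs = k \<Longrightarrow> f xs = h xs"
  using assms unfolding recursive_on_def by blast

lemma recursive_on_cong:
  assumes "recursive_on k f" "\<And>xs. length xs = k \<Longrightarrow> f xs = h xs"
  shows "recursive_on k h"
  using assms unfolding recursive_on_def by auto

lemma computable2I:
  assumes "recursive_on 2 (\<lambda>xs. h (xs ! 0) (xs ! 1))"
  shows "computable2 h"
proof -
  obtain f where f: "recursive_fn 2 f" "\<And>xs. length xs = 2 \<Longrightarrow> f xs = h (xs ! 0) (xs ! 1)"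
    using assms by (rule recursive_onE) blast
  have "f [n, m] = h n m" for n m
    using f(2)[of "[n, m]"] by simp
  with f(1) show ?thesis
    unfolding computable2_def by blast
qed

lemma recursive_on_proj: "i < k \<Longrightarrow> recursive_on k (\<lambda>xs. xs ! i)"
  by (rule recursive_onI[OF recursive_fn.proj]) auto

lemma recursive_on_zero: "recursive_on k (\<lambda>xs. 0)"
  by (rule recursive_onI[OF recursive_fn.zero]) simp

lemma recursive_on_Suc:
  assumes "recursive_on k g"
  shows "recursive_on k (\<lambda>xs. Suc (g xs))"
proof -
  obtain g' where g': "recursive_fn k g'" "\<And>xs. length xs = k \<Longrightarrow> g' xs = g xs"
    using assms by (rule recursive_onE) blast
  show ?thesis
    by (rule recursive_onI[OF recursive_fn.comp[where gs = "[g']", simplified, OF recursive_fn.succ[simplified]]])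
      (use g' in auto)
qed

lemma recursive_on_compose2:
  assumes "recursive_on 2 (\<lambda>xs. h (xs ! 0) (xs ! 1))" "recursive_on k g1" "recursive_on k g2"
  shows "recursive_on k (\<lambda>xs. h (g1 xs) (g2 xs))"
proof -
  obtain h' where h': "recursive_fn 2 h'" "\<And>xs. length xs = 2 \<Longrightarrow> h' xs = h (xs ! 0) (xs ! 1)"
    using assms(1) by (rule recursive_onE) blast
  obtain f1 where f1: "recursive_fn k f1" "\<And>xs. length xs = k \<Longrightarrow> f1 xs = g1 xs"
    using assms(2) by (rule recursive_onE) blast
  obtain f2 where f2: "recursive_fn k f2" "\<And>xs. length xs = k \<Longrightarrow> f2 xs = g2 xs"
    using assms(3) by (rule recursive_onE) blast
  have "recursive_fn k (\<lambda>xs. h' (map (\<lambda>g. g xs) [f1, f2]))"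
    by (rule recursive_fn.comp) (use h' f1 f2 in \<open>auto simp: numeral_2_eq_2\<close>)
  then show ?thesis
    by (rule recursive_onI) (simp add: h' f1 f2)
qed

text \<open>
  The recursion is stated for a given function \<open>h\<close> that satisfies the recursion equation, so that the
  arithmetical operations themselves can be inserted, without reference to \<^const>\<open>rec_nat\<close>.
\<close>

lemma recursive_on_prim_rec2:
  assumes base: "recursive_on 1 (\<lambda>xs. h 0 (xs ! 0))"
    and step: "recursive_on 3 (\<lambda>xs. s (xs ! 0) (xs ! 1) (xs ! 2))"
    and rec: "\<And>y a. h (Suc y) a = s y (h y a) a"
  shows "recursive_on 2 (\<lambda>xs. h (xs ! 0) (xs ! 1))"
proof -
  obtain b where b: "recursive_fn 1 b" "\<And>xs. length xs = 1 \<Longrightarrow> b xs = h 0 (xs ! 0)"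
    using base by (rule recursive_onE) blast
  obtain t where t: "recursive_fn 3 t" "\<And>xs. length xs = 3 \<Longrightarrow> t xs = s (xs ! 0) (xs ! 1) (xs ! 2)"
    using step by (rule recursive_onE) blast
  have eq: "rec_nat (b [a]) (\<lambda>y r. t (y # r # [a])) y = h y a" for y a
    by (induction y) (simp_all add: b(2) t(2) rec)
  have "recursive_fn (Suc 1)
          (\<lambda>xs. rec_nat (b (tl xs)) (\<lambda>y r. t (y # r # tl xs)) (hd xs))"
    using b(1) t(1) by (intro recursive_fn.prec) (simp_all add: numeral_3_eq_3)
  then show ?thesis
    unfolding Suc_1
  proof (rule recursive_onI)
    fix xs :: "nat list"
    assume "length xs = 2"
    then obtain y a where "xs = [y, a]"
      by (auto simp: numeral_2_eq_2 length_Suc_conv)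
    then show "rec_nat (b (tl xs)) (\<lambda>y r. t (y # r # tl xs)) (hd xs) = h (xs ! 0) (xs ! 1)"
      using eq by simp
  qed
qed

lemma recursive_on_Least2:
  assumes f: "recursive_on 3 (\<lambda>xs. f (xs ! 0) (xs ! 1) (xs ! 2))"
    and ex: "\<And>n m. \<exists>y. f y n m = 0"
  shows "recursive_on 2 (\<lambda>xs. LEAST y. f y (xs ! 0) (xs ! 1) = 0)"
proof -
  obtain t where t: "recursive_fn 3 t" "\<And>xs. length xs = 3 \<Longrightarrow> t xs = f (xs ! 0) (xs ! 1) (xs ! 2)"
    using f by (rule recursive_onE) blast
  have eq: "t (y # xs) = f y (xs ! 0) (xs ! 1)" if "length xs = 2" for y xs
    using that by (simp add: t(2))
  have "recursive_fn 2 (\<lambda>xs. LEAST y. t (y # xs) = 0)"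
    using t(1) ex by (intro recursive_fn.mini) (simp_all add: eq)
  then show ?thesis
    by (rule recursive_onI) (simp add: eq)
qed

section \<open>Arithmetic\<close>

lemma recursive_on_add:
  assumes "recursive_on k f" "recursive_on k g"
  shows "recursive_on k (\<lambda>xs. f xs + g xs)"
proof (rule recursive_on_compose2[OF _ assms])
  show "recursive_on 2 (\<lambda>xs. xs ! 0 + xs ! 1)"
    proof (rule recursive_on_prim_rec2[where s = "\<lambda>y r a. Suc r"])
    show "recursive_on 1 (\<lambda>xs. 0 + xs ! 0)"
      by (simp add: recursive_on_proj)
    show "recursive_on 3 (\<lambda>xs. Suc (xs ! 1))"
      by (intro recursive_on_Suc recursive_on_proj) simp
  qed simp
qed

lemma recursive_on_mult:
  assumes "recursive_on k f" "recursive_on k g"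
  shows "recursive_on k (\<lambda>xs. f xs * g xs)"
proof (rule recursive_on_compose2[OF _ assms])
  show "recursive_on 2 (\<lambda>xs. xs ! 0 * xs ! 1)"
    proof (rule recursive_on_prim_rec2[where s = "\<lambda>y r a. a + r"])
    show "recursive_on 1 (\<lambda>xs. 0 * xs ! 0)"
      by (simp add: recursive_on_zero)
    show "recursive_on 3 (\<lambda>xs. xs ! 2 + xs ! 1)"
      by (intro recursive_on_add recursive_on_proj) simp_all
  qed simp
qed

lemma recursive_on_pred:
  assumes "recursive_on k f"
  shows "recursive_on k (\<lambda>xs. f xs - 1)"
proof (rule recursive_on_compose2[where h = "\<lambda>y _. y - 1", OF _ assms assms])
  show "recursive_on 2 (\<lambda>xs. xs ! 0 - 1)"
    proof (rule recursive_on_prim_rec2[where h = "\<lambda>y _. y - 1" and s = "\<lambda>y r a. y"])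
    show "recursive_on 1 (\<lambda>xs. 0 - 1)"
      by (simp add: recursive_on_zero)
    show "recursive_on 3 (\<lambda>xs. xs ! 0)"
      by (intro recursive_on_proj) simp
  qed simp
qed

lemma recursive_on_diff:
  assumes "recursive_on k f" "recursive_on k g"
  shows "recursive_on k (\<lambda>xs. f xs - g xs)"
proof (rule recursive_on_compose2[where h = "\<lambda>y a. a - y", OF _ assms(2,1)])
  \<comment> \<open>The recursion is on the subtrahend, hence the exchanged arguments.\<close>
  show "recursive_on 2 (\<lambda>xs. xs ! 1 - xs ! 0)"
    proof (rule recursive_on_prim_rec2[where h = "\<lambda>y a. a - y" and s = "\<lambda>y r a. r - 1"])
    show "recursive_on 1 (\<lambda>xs. xs ! 0 - 0)"
      by (simp add: recursive_on_proj)
    show "recursive_on 3 (\<lambda>xs. xs ! 1 - 1)"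
      by (intro recursive_on_pred recursive_on_proj) simp
  qed simp
qed

lemma recursive_on_if_eq:
  assumes "recursive_on k a" "recursive_on k b" "recursive_on k f" "recursive_on k g"
  shows "recursive_on k (\<lambda>xs. if a xs = b xs then f xs else g xs)"
proof (rule recursive_on_cong)
  \<comment> \<open>The distance of \<open>a\<close> and \<open>b\<close> vanishes iff they are equal; \<open>1 - _\<close> is negation.\<close>
  let ?ne = "\<lambda>xs. (a xs - b xs) + (b xs - a xs)"
  show "recursive_on k (\<lambda>xs. (Suc 0 - ?ne xs) * f xs + (Suc 0 - (Suc 0 - ?ne xs)) * g xs)"
    by (intro recursive_on_add recursive_on_mult recursive_on_diff recursive_on_Suc
        recursive_on_zero assms)
  show "(Suc 0 - ?ne xs) * f xs + (Suc 0 - (Suc 0 - ?ne xs)) * g xs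
      = (if a xs = b xs then f xs else g xs)" for xs
    by (cases "?ne xs") auto
qed

lemma recursive_on_mod:
  assumes "recursive_on k f" "recursive_on k g"
  shows "recursive_on k (\<lambda>xs. f xs mod g xs)"
proof (rule recursive_on_compose2[OF _ assms])
  show "recursive_on 2 (\<lambda>xs. xs ! 0 mod xs ! 1)"
    proof (rule recursive_on_prim_rec2[where s = "\<lambda>y r a. if Suc r = a then 0 else Suc r"])
    show "recursive_on 1 (\<lambda>xs. 0 mod xs ! 0)"
      by (simp add: recursive_on_zero)
    show "recursive_on 3 (\<lambda>xs. if Suc (xs ! 1) = xs ! 2 then 0 else Suc (xs ! 1))"
      by (intro recursive_on_if_eq recursive_on_Suc recursive_on_zero recursive_on_proj) simp_all
  qed (simp add: mod_Suc)
qed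

lemmas recursive_on_arith =
  recursive_on_proj recursive_on_zero recursive_on_Suc recursive_on_add recursive_on_mult
  recursive_on_diff recursive_on_mod

section \<open>Computing Bezout coefficients by search\<close>

text \<open>
  This is \<open>m / gcd n m\<close> for \<open>m > 0\<close>. Searching for the predecessor excludes the trivial multiplier
  \<open>0\<close>.
\<close>

definition cofactor :: "nat \<Rightarrow> nat \<Rightarrow> nat" where
  "cofactor n m = Suc (LEAST y. m * ((Suc y * n) mod m) = 0)"

definition search_gcd :: "nat \<Rightarrow> nat \<Rightarrow> nat" where
  "search_gcd n m = (LEAST y. m - y * cofactor n m = 0)"

definition bezout_coeff_fst :: "nat \<Rightarrow> nat \<Rightarrow> nat" where
  "bezout_coeff_fst n m = (LEAST y. m * ((search_gcd n m + y * n) mod m) = 0)"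

definition bezout_coeff_snd :: "nat \<Rightarrow> nat \<Rightarrow> nat" where
  "bezout_coeff_snd n m = (LEAST y. m * (search_gcd n m + bezout_coeff_fst n m * n - y * m) = 0)"

text \<open>
  With \<open>g = gcd n m\<close>, the numbers \<open>m div g\<close> and \<open>n div g\<close> are coprime, so \<open>m\<close> divides \<open>k * n\<close>
  exactly if \<open>m div g\<close> divides \<open>k\<close>.
\<close>

lemma cofactor_eq:
  assumes "m > 0"
  shows "cofactor n m = m div gcd n m"
proof -
  define g where "g = gcd n m"
  define q where "q = m div g"
  define p where "p = n div g"
  have g: "g > 0"
    using assms by (simp add: g_def)
  have m: "m = q * g" and n: "n = p * g"
    by (simp_all add: g_def q_def p_def)
  have q: "q > 0"
    using assms m by (cases q) auto
  have cop: "coprime q p"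
    using div_gcd_coprime[of n m] assms
    by (simp add: p_def q_def g_def coprime_commute)
  have "m dvd k * n \<longleftrightarrow> q * g dvd (k * p) * g" for k
    by (simp add: m n mult.assoc)
  also have "q * g dvd (k * p) * g \<longleftrightarrow> q dvd k" for k
    using g cop by (simp add: coprime_dvd_mult_left_iff)
  finally have dvd: "m dvd k * n \<longleftrightarrow> q dvd k" for k .
  have "(LEAST y. m * ((Suc y * n) mod m) = 0) = (LEAST y. q dvd Suc y)"
    using assms dvd by (simp add: mod_eq_0_iff_dvd del: mult_Suc)
  also have "\<dots> = q - 1"
    using q by (intro Least_equality) (auto dest: dvd_imp_le)
  finally show ?thesis
    using q by (simp add: cofactor_def q_def g_def)
qed

text \<open>Division is replaced by search: \<open>gcd n m\<close> is the quotient of \<open>m\<close> by its cofactor.\<close>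

lemma search_gcd_eq:
  assumes "m > 0"
  shows "search_gcd n m = gcd n m"
proof -
  define q where "q = m div gcd n m"
  have m: "m = gcd n m * q"
    by (simp add: q_def)
  with assms have q: "q > 0"
    by (cases q) auto
  have "search_gcd n m = (LEAST y. m \<le> y * q)"
    using assms by (simp add: search_gcd_def cofactor_eq q_def)
  also have "\<dots> = gcd n m"
  proof (rule Least_equality)
    show "m \<le> gcd n m * q"
      using m by simp
    show "gcd n m \<le> y" if "m \<le> y * q" for y
      using that q m by (metis mult_le_cancel2)
  qed
  finally show ?thesis .
qed

text \<open>
  This is where Bezout's identity enters: in its one-sided form over \<open>\<nat>\<close> it asks only for the
  argument whose coefficient is on the larger side to be nonzero, here \<open>m\<close>.
\<close>

lemma bezout_search_succeeds: "\<exists>y. m * ((search_gcd n m + y * n) mod m) = 0"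
proof (cases "m = 0")
  case False
  then obtain x y where "m * x = n * y + gcd m n"
    using bezout_nat by blast
  then have "search_gcd n m + y * n = m * x"
    using False by (simp add: search_gcd_eq gcd.commute mult.commute)
  then show ?thesis
    by (intro exI[of _ y]) simp
qed simp

lemma bezout_coeffs_correct:
  assumes "m > 0"
  shows "gcd n m + bezout_coeff_fst n m * n = bezout_coeff_snd n m * m"
proof -
  define c where "c = gcd n m + bezout_coeff_fst n m * n"
  have "m * ((search_gcd n m + bezout_coeff_fst n m * n) mod m) = 0"
    unfolding bezout_coeff_fst_def by (rule LeastI_ex[OF bezout_search_succeeds])
  then have "m dvd c"
    using assms by (simp add: c_def search_gcd_eq mod_eq_0_iff_dvd)
  then obtain x where x: "c = x * m"
    by (metis dvd_def mult.commute)
  have "bezout_coeff_snd n m = (LEAST y. c \<le> y * m)"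
    using assms by (simp add: bezout_coeff_snd_def c_def search_gcd_eq)
  also have "\<dots> = x"
    using assms x by (intro Least_equality) auto
  finally show ?thesis
    using x by (simp add: c_def)
qed

lemma recursive_on_cofactor: "recursive_on 2 (\<lambda>xs. cofactor (xs ! 0) (xs ! 1))"
  unfolding cofactor_def
proof (intro recursive_on_Suc recursive_on_Least2)
  show "recursive_on 3 (\<lambda>xs. xs ! 2 * (Suc (xs ! 0) * xs ! 1 mod xs ! 2))"
    by (intro recursive_on_arith) simp_all
  show "\<exists>y. m * (Suc y * n mod m) = 0" for n m :: nat
    by (rule exI[of _ "m - 1"], cases m) (simp_all del: mult_Suc)
qed

lemma recursive_on_search_gcd: "recursive_on 2 (\<lambda>xs. search_gcd (xs ! 0) (xs ! 1))"
  unfolding search_gcd_def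
proof (rule recursive_on_Least2)
  have "recursive_on 3 (\<lambda>xs. cofactor (xs ! 1) (xs ! 2))"
    by (intro recursive_on_compose2[OF recursive_on_cofactor] recursive_on_proj) simp_all
  then show "recursive_on 3 (\<lambda>xs. xs ! 2 - xs ! 0 * cofactor (xs ! 1) (xs ! 2))"
    by (intro recursive_on_arith) simp_all
  show "\<exists>y. m - y * cofactor n m = 0" for n m
    by (rule exI[of _ m]) (simp add: cofactor_def)
qed

lemma recursive_on_bezout_coeff_fst:
  "recursive_on 2 (\<lambda>xs. bezout_coeff_fst (xs ! 0) (xs ! 1))"
  unfolding bezout_coeff_fst_def
proof (rule recursive_on_Least2)
  have "recursive_on 3 (\<lambda>xs. search_gcd (xs ! 1) (xs ! 2))"
    by (intro recursive_on_compose2[OF recursive_on_search_gcd] recursive_on_proj) simp_all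
  then show "recursive_on 3 (\<lambda>xs. xs ! 2 * ((search_gcd (xs ! 1) (xs ! 2) + xs ! 0 * xs ! 1) mod xs ! 2))"
    by (intro recursive_on_arith) simp_all
qed (rule bezout_search_succeeds)

lemma recursive_on_bezout_coeff_snd:
  "recursive_on 2 (\<lambda>xs. bezout_coeff_snd (xs ! 0) (xs ! 1))"
  unfolding bezout_coeff_snd_def
proof (rule recursive_on_Least2)
  have "recursive_on 3 (\<lambda>xs. search_gcd (xs ! 1) (xs ! 2))"
    "recursive_on 3 (\<lambda>xs. bezout_coeff_fst (xs ! 1) (xs ! 2))"
    by (intro recursive_on_compose2[OF recursive_on_search_gcd]
        recursive_on_compose2[OF recursive_on_bezout_coeff_fst] recursive_on_proj; simp)+
  then show "recursive_on 3 (\<lambda>xs. xs ! 2 * (search_gcd (xs ! 1) (xs ! 2)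
      + bezout_coeff_fst (xs ! 1) (xs ! 2) * xs ! 1 - xs ! 0 * xs ! 2))"
    by (intro recursive_on_arith) simp_all
  show "\<exists>y. m * (search_gcd n m + bezout_coeff_fst n m * n - y * m) = 0" for n m
    by (cases "m = 0") (auto simp: search_gcd_eq bezout_coeffs_correct)
qed

theorem theorem1:
  "(\<forall>n m :: nat. \<exists>l0 l1 :: nat.
      sub_gcd n m + l0 * n = l1 * m \<or> sub_gcd n m + l0 * m = l1 * n) \<and>
   (\<exists>l0 l1 d :: nat \<Rightarrow> nat \<Rightarrow> nat.
      computable2 l0 \<and> computable2 l1 \<and> computable2 d \<and>
      (\<forall>n m :: nat.
         (d n m = 0 \<longrightarrow> sub_gcd n m + l0 n m * n = l1 n m * m) \<and>
         (d n m \<noteq> 0 \<longrightarrow> sub_gcd n m + l0 n m * m = l1 n m * n)))"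
proof -
  define d :: "nat \<Rightarrow> nat \<Rightarrow> nat" where "d = (\<lambda>n m. Suc 0 - m)"
  \<comment> \<open>For \<open>m = 0\<close> the search returns \<open>0\<close>, and \<open>d\<close> supplies the coefficient \<open>1\<close> needed there.\<close>
  define l1 where "l1 = (\<lambda>n m. bezout_coeff_snd n m + d n m)"
  have d: "recursive_on 2 (\<lambda>xs. d (xs ! 0) (xs ! 1))"
    unfolding d_def by (intro recursive_on_arith) simp
  then have "computable2 d"
    by (rule computable2I)
  moreover have "computable2 l1"
    unfolding l1_def
    by (intro computable2I recursive_on_add recursive_on_bezout_coeff_snd d)
  moreover have "computable2 bezout_coeff_fst"
    by (intro computable2I recursive_on_bezout_coeff_fst)
  moreover have correct: "(d n m = 0 \<longrightarrow> sub_gcd n m + bezout_coeff_fst n m * n = l1 n m * m) \<and>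
      (d n m \<noteq> 0 \<longrightarrow> sub_gcd n m + bezout_coeff_fst n m * m = l1 n m * n)" for n m
  proof (cases "m = 0")
    case True
    then show ?thesis
      by (simp add: d_def l1_def bezout_coeff_snd_def sub_gcd_eq_gcd)
  next
    case False
    then show ?thesis
      by (simp add: d_def l1_def sub_gcd_eq_gcd bezout_coeffs_correct)
  qed
  ultimately show ?thesis
    by metis
qed

end
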